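(* Let $d\in\{1,2\}$. For every poset $P$, the local dimension of $P$ is equal to $d$ if and only if the dimension of $P$ is equal to $d$.
   Context: Let $P=(X,\leq)$ be a poset. Dimension: a realizer of $P$ is a set $\{\leq_1,\ldots,\leq_d\}$ of linear extensions of $\leq$ on $X$ such that for all $x,y\in X$: $x\leq y$ if and only if $x\leq_i y$ for every $i\in\{1,\ldots,d\}$. The dimension of $P$ is the minimum size of a realizer of $P$. Local dimension: a partial linear extension of $\leq$ is a linear extension of the restriction of $\leq$ to some subset of $X$. A local realizer of $P$ of width $d$ is a set $\{\leq_1,\ldots,\leq_t\}$ of partial linear extensions of $\leq$ such that every element of $X$ occurs in (the ground sets of) at most $d$ of $\leq_1,\ldots,\leq_t$, and for all $x,y\in X$: $x\leq y$ if and only if there is no $i\in\{1,\ldots,t\}$ with $x>_i y$ (where $x>_i y$ means that both $x$ and $y$ occur in $\leq_i$ and $x$ is strictly greater than $y$ there). The local dimension of $P$ is the minimum width of a local realizer of $P$. *)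

theory Defs
  imports Main "HOL-Library.Extended_Nat"
begin

text \<open>
  A poset is a carrier set \<open>X\<close> with a reflexive order relation \<open>r\<close> satisfying
  \<open>partial_order_on X r\<close>; \<open>(x, y) \<in> r\<close> means \<open>x \<le> y\<close>.  Linear orders are reflexive as well, so
  that the ground set of a partial linear extension \<open>L\<close> is \<open>Field L\<close>.
\<close>

definition linear_extension :: "'a set \<Rightarrow> 'a rel \<Rightarrow> 'a rel \<Rightarrow> bool" where
  "linear_extension X r L \<longleftrightarrow> linear_order_on X L \<and> r \<subseteq> L"

definition partial_linear_extension :: "'a set \<Rightarrow> 'a rel \<Rightarrow> 'a rel \<Rightarrow> bool" where
  "partial_linear_extension X r L \<longleftrightarrow> (\<exists>A\<subseteq>X. linear_extension A (Restr r A) L)"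

definition realizer :: "'a set \<Rightarrow> 'a rel \<Rightarrow> 'a rel set \<Rightarrow> bool" where
  "realizer X r R \<longleftrightarrow>
     finite R \<and> (\<forall>L\<in>R. linear_extension X r L) \<and>
     (\<forall>x\<in>X. \<forall>y\<in>X. (x, y) \<in> r \<longleftrightarrow> (\<forall>L\<in>R. (x, y) \<in> L))"

definition local_realizer :: "'a set \<Rightarrow> 'a rel \<Rightarrow> nat \<Rightarrow> 'a rel set \<Rightarrow> bool" where
  "local_realizer X r d R \<longleftrightarrow>
     finite R \<and> (\<forall>L\<in>R. partial_linear_extension X r L) \<and>
     (\<forall>x\<in>X. card {L \<in> R. x \<in> Field L} \<le> d) \<and>
     (\<forall>x\<in>X. \<forall>y\<in>X. (x, y) \<in> r \<longleftrightarrow> \<not> (\<exists>L\<in>R. (y, x) \<in> L \<and> x \<noteq> y))"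

text \<open>
  Both parameters are minima over a set of natural numbers, taken in \<^typ>\<open>enat\<close> so that the value
  is \<open>\<infinity>\<close> when the set is empty (possible only for infinite posets).  The empty family is admitted
  in both cases, so a poset with at most one element has dimension and local dimension \<open>0\<close>.
\<close>

definition poset_dimension :: "'a set \<Rightarrow> 'a rel \<Rightarrow> enat" where
  "poset_dimension X r = Inf {enat (card R) | R. realizer X r R}"

definition local_dimension :: "'a set \<Rightarrow> 'a rel \<Rightarrow> enat" where
  "local_dimension X r = Inf {enat d | d. \<exists>R. local_realizer X r d R}"

end

theory Submission
  imports Defs
begin

text \<open>
  If the local width is at most \<open>2\<close>, two incomparable elements occur in the same two members of the
  local realizer, since they must be seen in both orders. Break each incomparable pair according to
  the first, respectively the second, of these two members: the two relations so obtained already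
  are linear orders, and they form a realizer. Widths \<open>0\<close> and \<open>1\<close> exclude incomparable pairs.
\<close>

section \<open>Bounds on minima in \<open>enat\<close> as existence statements\<close>

lemma Inf_enat_le_iff: "Inf A \<le> enat k \<longleftrightarrow> (\<exists>a\<in>A. a \<le> enat k)"
proof
  assume le: "Inf A \<le> enat k"
  then have "A \<noteq> {}"
    by (auto simp: Inf_enat_def)
  \<comment> \<open>The order on \<open>enat\<close> is a well-order, so the infimum of a nonempty
    set is attained; the empty set has infimum \<infinity>.\<close>
  then have "Inf A \<in> A"
    unfolding Inf_enat_def by (auto intro: LeastI)
  with le show "\<exists>a\<in>A. a \<le> enat k" ..
qed (auto intro: Inf_lower2)

text \<open>Reduces equality of the two parameters to equivalence of upper bounds. For
  \<open>d = 0\<close> truncated subtraction would make the right side contradictory.\<close>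

lemma eq_enat_iff_le: "a = enat d \<longleftrightarrow> a \<le> enat d \<and> \<not> a \<le> enat (d - 1)" if "0 < d"
  using that by (cases a) auto

lemma poset_dimension_le_iff:
  "poset_dimension X r \<le> enat k \<longleftrightarrow> (\<exists>R. realizer X r R \<and> card R \<le> k)"
  unfolding poset_dimension_def Inf_enat_le_iff by auto

lemma local_realizer_mono: "local_realizer X r d R \<Longrightarrow> d \<le> k \<Longrightarrow> local_realizer X r k R"
  unfolding local_realizer_def by (meson order_trans)

lemma local_dimension_le_iff:
  "local_dimension X r \<le> enat k \<longleftrightarrow> (\<exists>R. local_realizer X r k R)"
proof -
  have "(\<exists>d\<le>k. \<exists>R. local_realizer X r d R) \<longleftrightarrow> (\<exists>R. local_realizer X r k R)"
    by (metis local_realizer_mono order_refl)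
  then show ?thesis
    unfolding local_dimension_def Inf_enat_le_iff by auto
qed

section \<open>Realizers as local realizers\<close>

lemma Field_linear_order_on: "linear_order_on A L \<Longrightarrow> Field L = A"
  unfolding order_on_defs refl_on_def Field_def by auto

text \<open>The ground set hidden in the existential can only be \<open>Field L\<close>, since
  linear orders are reflexive here.\<close>

lemma partial_linear_extension_iff:
  "partial_linear_extension X r L \<longleftrightarrow>
     Field L \<subseteq> X \<and> linear_order_on (Field L) L \<and> Restr r (Field L) \<subseteq> L"
  unfolding partial_linear_extension_def linear_extension_def
  by (metis Field_linear_order_on)

lemma local_realizer_if_realizer:
  assumes "realizer X r R" and "partial_order_on X r"
  shows "local_realizer X r (card R) R"
proof -
  have fin: "finite R" and real: "\<And>x y. x \<in> X \<Longrightarrow> y \<in> X \<Longrightarrow> (x, y) \<in> r \<longleftrightarrow> (\<forall>L\<in>R. (x, y) \<in> L)"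
    and lin: "\<And>L. L \<in> R \<Longrightarrow> linear_order_on X L" and sub: "\<And>L. L \<in> R \<Longrightarrow> r \<subseteq> L"
    using assms(1) unfolding realizer_def linear_extension_def by auto
  have "partial_linear_extension X r L" if "L \<in> R" for L
    using lin[OF that] sub[OF that] unfolding partial_linear_extension_iff
    by (auto simp: Field_linear_order_on)
  moreover have "card {L \<in> R. x \<in> Field L} \<le> card R" for x
    using fin by (auto intro: card_mono)
  moreover have "(x, y) \<in> r \<longleftrightarrow> \<not> (\<exists>L\<in>R. (y, x) \<in> L \<and> x \<noteq> y)" if "x \<in> X" "y \<in> X" for x y
  proof -
    \<comment> \<open>By totality and antisymmetry, \<open>x \<le> y\<close> fails in a linear order
      exactly when \<open>y\<close> lies strictly below \<open>x\<close>; so the two conditions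
      agree member by member.\<close>
    have "(x, y) \<in> L \<longleftrightarrow> \<not> ((y, x) \<in> L \<and> x \<noteq> y)" if "L \<in> R" for L
      using lin[OF that] \<open>x \<in> X\<close> \<open>y \<in> X\<close>
      unfolding order_on_defs refl_on_def total_on_def antisym_def by metis
    then show ?thesis
      using real[OF that] by auto
  qed
  ultimately show ?thesis
    using fin unfolding local_realizer_def by auto
qed

section \<open>From local width 2 to two linear extensions\<close>

lemma realizer_if_local_realizer_2:
  assumes R: "local_realizer X r 2 R" and po: "partial_order_on X r"
  shows "\<exists>R'. realizer X r R' \<and> card R' \<le> 2"
proof -
  define S where "S x = {L \<in> R. x \<in> Field L}" for x
  define inc where "inc x y \<longleftrightarrow> x \<in> X \<and> y \<in> X \<and> (x, y) \<notin> r \<and> (y, x) \<notin> r" for x y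
  have finR: "finite R" and card_S: "\<And>x. x \<in> X \<Longrightarrow> card (S x) \<le> 2"
    using R unfolding local_realizer_def S_def by auto
  have ple: "\<And>L. L \<in> R \<Longrightarrow> linear_order_on (Field L) L \<and> Restr r (Field L) \<subseteq> L"
    using R unfolding local_realizer_def partial_linear_extension_iff by auto
  have witness: "\<exists>L\<in>R. (y, x) \<in> L \<and> x \<noteq> y" if "x \<in> X" "y \<in> X" "(x, y) \<notin> r" for x y
    using R that unfolding local_realizer_def by blast
  have ext: "(x, y) \<in> L" if "L \<in> R" "x \<in> Field L" "y \<in> Field L" "(x, y) \<in> r" for L x y
    using ple[OF that(1)] that by auto
  have L_antisym: "x = y" if "L \<in> R" "(x, y) \<in> L" "(y, x) \<in> L" for L x y
    using ple[OF that(1)] that unfolding order_on_defs antisym_def by metis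
  have L_trans: "(x, z) \<in> L" if "L \<in> R" "(x, y) \<in> L" "(y, z) \<in> L" for L x y z
    using ple[OF that(1)] that unfolding order_on_defs trans_def by metis
  have L_total: "(x, y) \<in> L \<or> (y, x) \<in> L" if "L \<in> R" "x \<in> Field L" "y \<in> Field L" for L x y
    using ple[OF that(1)] that unfolding order_on_defs total_on_def refl_on_def by metis
  have r_refl: "(x, x) \<in> r" if "x \<in> X" for x
    using po that unfolding order_on_defs refl_on_def by auto
  have r_sub: "r \<subseteq> X \<times> X"
    using po unfolding order_on_defs by auto
  have r_trans: "(x, z) \<in> r" if "(x, y) \<in> r" "(y, z) \<in> r" for x y z
    using po that unfolding order_on_defs trans_def by metis
  have r_antisym: "x = y" if "(x, y) \<in> r" "(y, x) \<in> r" for x y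
    using po that unfolding order_on_defs antisym_def by metis
  have inc_sym: "inc y x" if "inc x y" for x y
    using that unfolding inc_def by auto

  have inc_S: "\<exists>L L'. S x = {L, L'} \<and> S y = {L, L'} \<and> (y, x) \<in> L \<and> (x, y) \<in> L'"
    if inc: "inc x y" for x y
  proof -
    obtain L where L: "L \<in> R" "(y, x) \<in> L" "x \<noteq> y"
      using witness inc unfolding inc_def by blast
    obtain L' where L': "L' \<in> R" "(x, y) \<in> L'"
      using witness inc unfolding inc_def by blast
    have "L \<noteq> L'"
      using L_antisym L L' by blast
    \<comment> \<open>The two witnesses already exhaust the width of both \<open>x\<close> and
      \<open>y\<close>, which forces \<open>S x\<close> and \<open>S y\<close> to be this
      pair.\<close>
    then have "card {L, L'} = 2"
      by simp
    moreover have "{L, L'} \<subseteq> S x" "{L, L'} \<subseteq> S y"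
      using L L' unfolding S_def by (auto simp: Field_def)
    moreover have "finite (S x)" "finite (S y)"
      using finR unfolding S_def by auto
    moreover have "card (S x) \<le> 2" "card (S y) \<le> 2"
      using card_S that unfolding inc_def by auto
    ultimately have "{L, L'} = S x" "{L, L'} = S y"
      by (simp_all only: card_seteq)
    then show ?thesis
      using L(2) L'(2) by metis
  qed
  have S_eq: "S x = S y" if "inc x y" for x y
    using inc_S[OF that] by auto

  \<comment> \<open>The choice \<open>f\<close> sees only the set \<open>S x\<close>, not
    \<open>x\<close> itself, so incomparable elements consult the same member.\<close>
  define M where "M f = r \<union> {(x, y). inc x y \<and> (x, y) \<in> f (S x)}" for f :: "'a rel set \<Rightarrow> 'a rel"
  have M_linear: "linear_extension X r (M f)" if f: "\<And>T. T \<noteq> {} \<Longrightarrow> f T \<in> T" for f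
  proof -
    have fS: "f (S x) \<in> R \<and> x \<in> Field (f (S x))" if "inc x y" for x y
    proof -
      have "S x \<noteq> {}"
        using inc_S[OF that] by auto
      then have "f (S x) \<in> S x"
        by (rule f)
      then show ?thesis
        unfolding S_def by auto
    qed
    have "trans (M f)"
    proof (rule transI)
      fix x y z
      assume xy: "(x, y) \<in> M f" and yz: "(y, z) \<in> M f"
      then have X: "x \<in> X" "z \<in> X"
        using r_sub unfolding M_def inc_def by auto
      consider "(x, y) \<in> r" "(y, z) \<in> r" | "(x, y) \<in> r" "inc y z" "(y, z) \<in> f (S y)"
        | "inc x y" "(x, y) \<in> f (S x)" "(y, z) \<in> r"
        | "inc x y" "(x, y) \<in> f (S x)" "inc y z" "(y, z) \<in> f (S y)"
        using xy yz unfolding M_def by auto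
      then show "(x, z) \<in> M f"
      proof cases
        case 1
        then show ?thesis
          using r_trans unfolding M_def by blast
      next
        case 2
        \<comment> \<open>\<open>z \<le> x \<le> y\<close> would make \<open>y\<close> and
          \<open>z\<close> comparable. If \<open>x\<close> and \<open>z\<close> are incomparable,
          all three elements share one chosen member, which contains \<open>(x, y)\<close> by
          \<open>ext\<close>.\<close>
        have "(z, x) \<notin> r"
          using 2 r_trans unfolding inc_def by blast
        moreover have "(x, z) \<in> f (S x)" if "inc x z"
        proof -
          have "S x = S y"
            using S_eq that 2 by metis
          then have "(x, y) \<in> f (S x)" "(y, z) \<in> f (S x)"
            using 2 ext fS that by metis+
          then show ?thesis
            using L_trans fS that by blast
        qed
        ultimately show ?thesis
          using X unfolding M_def inc_def by auto
      next
        case 3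
        have "(z, x) \<notin> r"
          using 3 r_trans unfolding inc_def by blast
        moreover have "(x, z) \<in> f (S x)" if "inc x z"
        proof -
          have "S x = S y" "S x = S z"
            using S_eq that 3 by metis+
          then have "(y, z) \<in> f (S x)"
            using 3 ext fS inc_sym that by metis
          then show ?thesis
            using L_trans fS that 3 by blast
        qed
        ultimately show ?thesis
          using X unfolding M_def inc_def by auto
      next
        case 4
        have S: "S x = S y" "S x = S z"
          using S_eq 4 by metis+
        have xz: "(x, z) \<in> f (S x)"
          using L_trans fS 4 S by metis
        \<comment> \<open>A comparability \<open>z \<le> x\<close> would also hold in the common
          member, against \<open>xz\<close> unless the two coincide.\<close>
        have "x = z" if "(z, x) \<in> r"
          using ext[OF _ _ _ that] L_antisym fS xz 4 S inc_sym by metis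
        then show ?thesis
          using X xz r_refl unfolding M_def inc_def by auto
      qed
    qed
    moreover have "antisym (M f)"
    proof (rule antisymI)
      fix x y
      assume "(x, y) \<in> M f" "(y, x) \<in> M f"
      \<comment> \<open>No mixed case arises: a pair comparable in \<open>r\<close> is not in
        \<open>inc\<close>.\<close>
      then consider "(x, y) \<in> r" "(y, x) \<in> r"
        | "inc x y" "(x, y) \<in> f (S x)" "(y, x) \<in> f (S y)"
        unfolding M_def inc_def by auto
      then show "x = y"
        using r_antisym L_antisym fS S_eq by cases metis+
    qed
    moreover have "total_on X (M f)"
    proof (rule total_onI)
      fix x y
      assume X: "x \<in> X" "y \<in> X"
      have "(x, y) \<in> f (S x) \<or> (y, x) \<in> f (S y)" if "inc x y"
        using L_total fS S_eq inc_sym that by metis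
      then show "(x, y) \<in> M f \<or> (y, x) \<in> M f"
        using X inc_sym unfolding M_def inc_def by auto
    qed
    moreover have "refl_on X (M f)" "M f \<subseteq> X \<times> X"
      using r_refl r_sub unfolding M_def inc_def refl_on_def by auto
    ultimately show ?thesis
      unfolding linear_extension_def order_on_defs by (auto simp: M_def)
  qed

  define f :: "'a rel set \<Rightarrow> 'a rel" where "f T = (SOME L. L \<in> T)" for T
  \<comment> \<open>A second choice, different from \<open>f T\<close> whenever \<open>T\<close> has
    another element; the default \<open>f T\<close> keeps \<open>g\<close> a choice function on
    singletons.\<close>
  define g where "g T = (if T \<subseteq> {f T} then f T else (SOME L. L \<in> T - {f T}))" for T
  have f: "f T \<in> T" if "T \<noteq> {}" for T
    using that unfolding f_def by (simp add: some_in_eq)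
  have g: "g T \<in> T \<and> (\<not> T \<subseteq> {f T} \<longrightarrow> g T \<noteq> f T)" if "T \<noteq> {}" for T
    using that f[OF that] some_in_eq[of "T - {f T}"] unfolding g_def by auto
  have fg: "{f {L, L'}, g {L, L'}} = {L, L'}" for L L'
    using f[of "{L, L'}"] g[of "{L, L'}"] by auto
  have "(x, y) \<in> r" if "x \<in> X" "y \<in> X" "(x, y) \<in> M f" "(x, y) \<in> M g" for x y
  proof (rule ccontr)
    assume "(x, y) \<notin> r"
    then have inc: "inc x y" and L: "(x, y) \<in> f (S x)" "(x, y) \<in> g (S x)"
      using that unfolding M_def by auto
    obtain L L' where S: "S x = {L, L'}" and yx: "(y, x) \<in> L"
      using inc_S[OF inc] by metis
    \<comment> \<open>Between them \<open>f\<close> and \<open>g\<close> consult both members of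
      \<open>S x\<close>, hence also the one that places \<open>y\<close> below
      \<open>x\<close>.\<close>
    have "L \<in> {f (S x), g (S x)}"
      unfolding S fg by simp
    then have xy: "(x, y) \<in> L"
      using L by auto
    have "L \<in> R"
      using S unfolding S_def by blast
    then have "x = y"
      using L_antisym xy yx by simp
    then show False
      using \<open>(x, y) \<notin> r\<close> r_refl that by blast
  qed
  then have "realizer X r {M f, M g}"
    using M_linear f g unfolding realizer_def by (auto simp: M_def)
  \<comment> \<open>Only an upper bound: \<open>M f\<close> and \<open>M g\<close> coincide when no
    pair is incomparable.\<close>
  moreover have "card {M f, M g} \<le> 2"
    by (simp add: card_insert_if)
  ultimately show ?thesis
    by blast
qed

section \<open>Widths 1 and 0\<close>

lemma realizer_if_local_realizer_1:
  assumes R: "local_realizer X r 1 R" and po: "partial_order_on X r"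
  shows "realizer X r {r}"
proof -
  have "(x, y) \<in> r \<or> (y, x) \<in> r" if X: "x \<in> X" "y \<in> X" for x y
  proof (rule ccontr)
    assume nc: "\<not> ((x, y) \<in> r \<or> (y, x) \<in> r)"
    obtain L where L: "L \<in> R" "(y, x) \<in> L" "x \<noteq> y"
      using R X nc unfolding local_realizer_def by blast
    obtain L' where L': "L' \<in> R" "(x, y) \<in> L'"
      using R X nc unfolding local_realizer_def by blast
    have "antisym L"
      using R L(1) unfolding local_realizer_def partial_linear_extension_iff order_on_defs by blast
    \<comment> \<open>The two orders of an incomparable pair need distinct members, both containing
      \<open>x\<close>, which exceeds width 1.\<close>
    then have "L \<noteq> L'"
      using L L' by (auto dest: antisymD)
    then have "card {L, L'} = 2"
      by simp
    moreover have "card {L, L'} \<le> card {L \<in> R. x \<in> Field L}"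
      using R L L' unfolding local_realizer_def by (intro card_mono) (auto simp: Field_def)
    ultimately show False
      using R X unfolding local_realizer_def by force
  qed
  then show ?thesis
    using po unfolding realizer_def linear_extension_def linear_order_on_def total_on_def by auto
qed

text \<open>With no element of \<open>X\<close> in any member, no pair is ever reversed, so all
  pairs from \<open>X\<close> lie in \<open>r\<close>; this is what the empty realizer
  demands.\<close>

lemma realizer_if_local_realizer_0:
  assumes R: "local_realizer X r 0 R"
  shows "realizer X r {}"
proof -
  have "x \<notin> Field L" if "x \<in> X" "L \<in> R" for x L
    using R that unfolding local_realizer_def by auto
  then have "(x, y) \<notin> L" if "x \<in> X" "L \<in> R" for x y L
    using that by (auto simp: Field_def)
  then show ?thesis
    using R unfolding local_realizer_def realizer_def by auto
qed

section \<open>Comparison of the two dimensions\<close>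

lemma local_dimension_le_iff_poset_dimension_le:
  assumes "k \<le> 2" and po: "partial_order_on X r"
  shows "local_dimension X r \<le> enat k \<longleftrightarrow> poset_dimension X r \<le> enat k"
  unfolding local_dimension_le_iff poset_dimension_le_iff
proof
  assume "\<exists>R. local_realizer X r k R"
  then obtain R where R: "local_realizer X r k R" ..
  \<comment> \<open>The bound 0 is included because dimension exactly 1 means at most 1 and not at
    most 0.\<close>
  consider "k = 0" | "k = 1" | "k = 2"
    using assms(1) by linarith
  then show "\<exists>R. realizer X r R \<and> card R \<le> k"
  proof cases
    case 1
    then have "realizer X r {}" "card ({} :: 'a rel set) \<le> k"
      using realizer_if_local_realizer_0 R by auto
    then show ?thesis by blast
  next
    case 2
    then have "realizer X r {r}" "card {r} \<le> k"
      using realizer_if_local_realizer_1 R po by auto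
    then show ?thesis by blast
  next
    case 3
    then show ?thesis
      using realizer_if_local_realizer_2 R po by blast
  qed
next
  assume "\<exists>R. realizer X r R \<and> card R \<le> k"
  then show "\<exists>R. local_realizer X r k R"
    using local_realizer_mono[OF local_realizer_if_realizer[OF _ po]] by metis
qed

theorem mainTheorem1:
  fixes X :: "'a set" and r :: "'a rel" and d :: nat
  assumes "d \<in> {1, 2}"
    and "partial_order_on X r"
  shows "local_dimension X r = enat d \<longleftrightarrow> poset_dimension X r = enat d"
proof -
  \<comment> \<open>Both thresholds \<open>d\<close> and \<open>d - 1\<close> stay in the range
    where the two upper bounds are equivalent.\<close>
  have "0 < d" "d \<le> 2" "d - 1 \<le> 2"
    using assms(1) by auto
  then show ?thesis
    using assms(2) by (simp add: eq_enat_iff_le local_dimension_le_iff_poset_dimension_le)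
qed

end
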